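(* Let $G$ be a group, let $\phi\in\operatorname{Aut}(G)$, and let $$M_\phi=G\rtimes_\phi\mathbb{Z}=\langle G,t \;:\; w^t=w\phi \text{ for all } w\in G\rangle$$ be the mapping torus of $\phi$. Let $\chi\in\operatorname{Aut}(G)$. Then $\chi$ commutes with $\phi$ as an outer automorphism (that is, $[\phi,\chi]\in\operatorname{Inn}(G)$) if and only if for some $g\in G$ the map $$t\mapsto tg,\qquad w\mapsto w\chi\quad (w\in G)$$ defines an automorphism of $M_\phi$.
   Context: Automorphisms are written on the right: $w\phi$ is the image of $w$ under $\phi$, and products of automorphisms are composed left to right. $w^t:=t^{-1}wt$. $\operatorname{Inn}(G)$ is the group of inner automorphisms $\operatorname{Ad}(x): g\mapsto x^{-1}gx$, and $[\phi,\chi]=\phi^{-1}\chi^{-1}\phi\chi$. *)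

theory Defs
  imports "HOL-Algebra.Bij"
begin

text \<open>
  Automorphisms act on the right: \<open>w \<phi>\<close> is rendered as \<open>\<phi> w\<close>, and a product \<open>\<phi> \<psi>\<close> of automorphisms
  means: first \<open>\<phi>\<close>, then \<open>\<psi>\<close>.  The library group \<^const>\<open>AutoGroup\<close> composes in the opposite
  order, so the multiplication is replaced.
\<close>

definition right_AutoGroup :: "('a, 'b) monoid_scheme \<Rightarrow> ('a \<Rightarrow> 'a) monoid" where
  "right_AutoGroup G =
     \<lparr>carrier = auto G,
      mult = (\<lambda>\<phi> \<psi>. compose (carrier G) \<psi> \<phi>),
      one = (\<lambda>w \<in> carrier G. w)\<rparr>"

definition commutator :: "('a, 'b) monoid_scheme \<Rightarrow> 'a \<Rightarrow> 'a \<Rightarrow> 'a" where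
  "commutator G a b = inv\<^bsub>G\<^esub> a \<otimes>\<^bsub>G\<^esub> inv\<^bsub>G\<^esub> b \<otimes>\<^bsub>G\<^esub> a \<otimes>\<^bsub>G\<^esub> b"

definition Ad :: "('a, 'b) monoid_scheme \<Rightarrow> 'a \<Rightarrow> 'a \<Rightarrow> 'a" where
  "Ad G x = (\<lambda>g \<in> carrier G. inv\<^bsub>G\<^esub> x \<otimes>\<^bsub>G\<^esub> g \<otimes>\<^bsub>G\<^esub> x)"

definition Inn :: "('a, 'b) monoid_scheme \<Rightarrow> ('a \<Rightarrow> 'a) set" where
  "Inn G = Ad G ` carrier G"

text \<open>
  The pair \<open>(n, w)\<close> stands for \<open>t\<^sup>n w\<close>; the multiplication comes from
  \<open>t\<^sup>m v t\<^sup>n w = t\<^sup>m\<^sup>+\<^sup>n (t\<^sup>-\<^sup>n v t\<^sup>n) w\<close> and \<open>t\<^sup>-\<^sup>n v t\<^sup>n = v \<phi>\<^sup>n\<close>.  That this semidirect product is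
  the group with the presentation \<open>\<langle>G, t : w\<^sup>t = w \<phi>\<rangle>\<close> is shown below, in the form of the
  universal property.
\<close>

definition mapping_torus :: "('a, 'b) monoid_scheme \<Rightarrow> ('a \<Rightarrow> 'a) \<Rightarrow> (int \<times> 'a) monoid" where
  "mapping_torus G \<phi> =
     \<lparr>carrier = UNIV \<times> carrier G,
      mult = (\<lambda>(m, v) (n, w). (m + n, (\<phi> [^]\<^bsub>right_AutoGroup G\<^esub> n) v \<otimes>\<^bsub>G\<^esub> w)),
      one = (0, \<one>\<^bsub>G\<^esub>)\<rparr>"

definition mt_stable :: "('a, 'b) monoid_scheme \<Rightarrow> int \<times> 'a" where
  "mt_stable G = (1, \<one>\<^bsub>G\<^esub>)"

definition mt_incl :: "'a \<Rightarrow> int \<times> 'a" where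
  "mt_incl w = (0, w)"

lemma (in group) group_right_AutoGroup: "group (right_AutoGroup G)"
proof -
  interpret A: group "AutoGroup G" by (rule AutoGroup)
  have c: "carrier (AutoGroup G) = auto G"
    by (simp add: AutoGroup_def)
  have m: "x \<otimes>\<^bsub>AutoGroup G\<^esub> y = compose (carrier G) x y" if "x \<in> auto G" "y \<in> auto G" for x y
    using that by (simp add: AutoGroup_def BijGroup_def auto_def)
  have o: "\<one>\<^bsub>AutoGroup G\<^esub> = (\<lambda>w \<in> carrier G. w)"
    by (simp add: AutoGroup_def BijGroup_def)
  show ?thesis
  proof (rule groupI)
    fix x y assume "x \<in> carrier (right_AutoGroup G)" "y \<in> carrier (right_AutoGroup G)"
    then show "x \<otimes>\<^bsub>right_AutoGroup G\<^esub> y \<in> carrier (right_AutoGroup G)"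
      using A.m_closed[of y x] by (simp add: right_AutoGroup_def c m)
  next
    show "\<one>\<^bsub>right_AutoGroup G\<^esub> \<in> carrier (right_AutoGroup G)"
      by (simp add: right_AutoGroup_def id_in_auto)
  next
    fix x y z assume *: "x \<in> carrier (right_AutoGroup G)" "y \<in> carrier (right_AutoGroup G)"
      "z \<in> carrier (right_AutoGroup G)"
    then have "x \<in> auto G" "y \<in> auto G" "z \<in> auto G"
      by (simp_all add: right_AutoGroup_def)
    then show "x \<otimes>\<^bsub>right_AutoGroup G\<^esub> y \<otimes>\<^bsub>right_AutoGroup G\<^esub> z
        = x \<otimes>\<^bsub>right_AutoGroup G\<^esub> (y \<otimes>\<^bsub>right_AutoGroup G\<^esub> z)"
      using A.m_assoc[of z y x] A.m_closed[of y x] A.m_closed[of z y]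
      by (simp add: right_AutoGroup_def c m)
  next
    fix x assume "x \<in> carrier (right_AutoGroup G)"
    then have x: "x \<in> auto G" by (simp add: right_AutoGroup_def)
    show "\<one>\<^bsub>right_AutoGroup G\<^esub> \<otimes>\<^bsub>right_AutoGroup G\<^esub> x = x"
      using A.r_one[of x] x by (simp add: right_AutoGroup_def c m o id_in_auto)
    have "inv\<^bsub>AutoGroup G\<^esub> x \<in> auto G" using A.inv_closed[of x] x by (simp add: c)
    then show "\<exists>y\<in>carrier (right_AutoGroup G). y \<otimes>\<^bsub>right_AutoGroup G\<^esub> x = \<one>\<^bsub>right_AutoGroup G\<^esub>"
      using A.r_inv[of x] x by (intro bexI[of _ "inv\<^bsub>AutoGroup G\<^esub> x"])
        (auto simp add: right_AutoGroup_def c m o)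
  qed
qed

lemma carrier_mapping_torus: "(n, w) \<in> carrier (mapping_torus G \<phi>) \<longleftrightarrow> w \<in> carrier G"
  by (simp add: mapping_torus_def)

lemma mult_mapping_torus: "(m, v) \<otimes>\<^bsub>mapping_torus G \<phi>\<^esub> (n, w)
    = (m + n, (\<phi> [^]\<^bsub>right_AutoGroup G\<^esub> n) v \<otimes>\<^bsub>G\<^esub> w)"
  by (simp add: mapping_torus_def)

context group
begin

context
  fixes \<phi> assumes \<phi>: "\<phi> \<in> auto G"
begin

private abbreviation (input) act :: "int \<Rightarrow> 'a \<Rightarrow> 'a" where
  "act n \<equiv> \<phi> [^]\<^bsub>right_AutoGroup G\<^esub> n"

lemma auto_pow_in_auto: "act n \<in> auto G"
proof -
  interpret R: group "right_AutoGroup G" by (rule group_right_AutoGroup)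
  show ?thesis using R.int_pow_closed[of \<phi> n] \<phi> by (simp add: right_AutoGroup_def)
qed

lemma auto_pow_closed: "w \<in> carrier G \<Longrightarrow> act n w \<in> carrier G"
  using auto_pow_in_auto[of n] by (auto simp: auto_def hom_def)

lemma auto_pow_mult:
  "\<lbrakk>v \<in> carrier G; w \<in> carrier G\<rbrakk> \<Longrightarrow> act n (v \<otimes> w) = act n v \<otimes> act n w"
  using auto_pow_in_auto[of n] by (auto simp: auto_def hom_def)

lemma auto_pow_one: "act n \<one> = \<one>"
  using auto_pow_in_auto[of n] by (auto simp: auto_def intro: hom_one is_group)

lemma one_right_AutoGroup: "w \<in> carrier G \<Longrightarrow> \<one>\<^bsub>right_AutoGroup G\<^esub> w = w"
  by (simp add: right_AutoGroup_def)

lemma auto_pow_1: "act 1 = \<phi>"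
proof -
  interpret R: group "right_AutoGroup G" by (rule group_right_AutoGroup)
  show ?thesis using R.int_pow_1[of \<phi>] \<phi> by (simp add: right_AutoGroup_def)
qed

lemma auto_pow_add: "w \<in> carrier G \<Longrightarrow> act (m + n) w = act n (act m w)"
proof -
  interpret R: group "right_AutoGroup G" by (rule group_right_AutoGroup)
  have "act (m + n) = compose (carrier G) (act n) (act m)"
    using R.int_pow_mult[of \<phi> m n] \<phi> by (simp add: right_AutoGroup_def)
  then show "w \<in> carrier G \<Longrightarrow> act (m + n) w = act n (act m w)"
    by (simp add: compose_eq)
qed

lemma group_mapping_torus: "group (mapping_torus G \<phi>)"
proof (rule groupI)
  fix x assume "x \<in> carrier (mapping_torus G \<phi>)"
  then obtain n v where x: "x = (n, v)" "v \<in> carrier G"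
    by (auto simp: mapping_torus_def)
  have "(- n, act (- n) (inv v)) \<otimes>\<^bsub>mapping_torus G \<phi>\<^esub> x = \<one>\<^bsub>mapping_torus G \<phi>\<^esub>"
    using x auto_pow_add[of "inv v" "- n" n]
    by (simp add: mapping_torus_def one_right_AutoGroup)
  then show "\<exists>y\<in>carrier (mapping_torus G \<phi>). y \<otimes>\<^bsub>mapping_torus G \<phi>\<^esub> x = \<one>\<^bsub>mapping_torus G \<phi>\<^esub>"
    by (rule bexI) (simp add: carrier_mapping_torus auto_pow_closed x)
qed (auto simp: mapping_torus_def auto_pow_closed auto_pow_mult auto_pow_add auto_pow_one m_assoc
      add.assoc)

lemma mt_stable_closed: "mt_stable G \<in> carrier (mapping_torus G \<phi>)"
  by (simp add: mt_stable_def carrier_mapping_torus)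

lemma mt_incl_hom: "mt_incl \<in> hom G (mapping_torus G \<phi>)"
  by (auto simp: hom_def mt_incl_def mapping_torus_def one_right_AutoGroup)

lemma mapping_torus_relation:
  assumes w: "w \<in> carrier G"
  shows "inv\<^bsub>mapping_torus G \<phi>\<^esub> mt_stable G \<otimes>\<^bsub>mapping_torus G \<phi>\<^esub> mt_incl w
      \<otimes>\<^bsub>mapping_torus G \<phi>\<^esub> mt_stable G = mt_incl (\<phi> w)"
proof -
  interpret M: group "mapping_torus G \<phi>" by (rule group_mapping_torus)
  have \<phi>w: "\<phi> w \<in> carrier G"
    using auto_pow_closed[OF w, of 1] by (simp add: auto_pow_1)
  have c: "mt_incl u \<in> carrier (mapping_torus G \<phi>)" if "u \<in> carrier G" for u
    using that by (simp add: mt_incl_def carrier_mapping_torus)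
  have "mt_incl w \<otimes>\<^bsub>mapping_torus G \<phi>\<^esub> mt_stable G
      = mt_stable G \<otimes>\<^bsub>mapping_torus G \<phi>\<^esub> mt_incl (\<phi> w)"
    using w \<phi>w
    by (simp add: mt_incl_def mt_stable_def mult_mapping_torus auto_pow_1 auto_pow_one one_right_AutoGroup)
  then show ?thesis
    using w \<phi>w mt_stable_closed c by (simp add: M.m_assoc M.inv_solve_left')
qed

lemma mapping_torus_pow:
  "mt_stable G [^]\<^bsub>mapping_torus G \<phi>\<^esub> (n::int) = (n, \<one>)"
proof -
  interpret M: group "mapping_torus G \<phi>" by (rule group_mapping_torus)
  have "(1, \<one>) [^]\<^bsub>mapping_torus G \<phi>\<^esub> k = (int k, \<one>)" for k :: nat
  proof (induction k)
    case 0
    then show ?case by (simp add: mapping_torus_def)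
  next
    case (Suc k)
    then show ?case by (simp add: mult_mapping_torus auto_pow_one)
  qed
  then have *: "mt_stable G [^]\<^bsub>mapping_torus G \<phi>\<^esub> int k = (int k, \<one>)" for k
    by (simp add: mt_stable_def int_pow_int)
  have "inv\<^bsub>mapping_torus G \<phi>\<^esub> (int k, \<one>) = (- int k, \<one>)" for k
    by (rule M.inv_equality)
      (simp_all add: mult_mapping_torus carrier_mapping_torus auto_pow_one,
       simp add: mapping_torus_def)
  then show ?thesis
    using * mt_stable_closed by (cases n rule: int_cases2) (auto simp: M.int_pow_neg)
qed

lemma mapping_torus_decomp:
  assumes "w \<in> carrier G"
  shows "(n, w) = mt_stable G [^]\<^bsub>mapping_torus G \<phi>\<^esub> (n::int) \<otimes>\<^bsub>mapping_torus G \<phi>\<^esub> mt_incl w"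
  using assms
  by (simp add: mapping_torus_pow mt_incl_def mult_mapping_torus auto_pow_one one_right_AutoGroup)

text \<open>The universal property of the presentation: existence and uniqueness.\<close>

theorem mapping_torus_universal:
  assumes H: "group H" and f: "f \<in> hom G H" and s: "s \<in> carrier H"
    and rel: "\<And>w. w \<in> carrier G \<Longrightarrow> inv\<^bsub>H\<^esub> s \<otimes>\<^bsub>H\<^esub> f w \<otimes>\<^bsub>H\<^esub> s = f (\<phi> w)"
  shows "\<exists>F \<in> hom (mapping_torus G \<phi>) H.
    F (mt_stable G) = s \<and> (\<forall>w \<in> carrier G. F (mt_incl w) = f w)"
proof -
  interpret H: group H by (rule H)
  have fc: "f w \<in> carrier H" if "w \<in> carrier G" for w
    using f that by (auto simp: hom_def)
  have fm: "f (v \<otimes> w) = f v \<otimes>\<^bsub>H\<^esub> f w" if "v \<in> carrier G" "w \<in> carrier G" for v w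
    using f that by (auto simp: hom_def)
  have \<phi>c: "\<phi> w \<in> carrier G" if "w \<in> carrier G" for w
    using auto_pow_closed[OF that, of 1] by (simp add: auto_pow_1)
  have step: "f w \<otimes>\<^bsub>H\<^esub> s = s \<otimes>\<^bsub>H\<^esub> f (\<phi> w)" if "w \<in> carrier G" for w
    using rel[OF that] s fc that \<phi>c by (metis H.inv_closed H.inv_solve_left H.m_assoc H.m_closed)
  have step': "f (\<phi> w) \<otimes>\<^bsub>H\<^esub> inv\<^bsub>H\<^esub> s = inv\<^bsub>H\<^esub> s \<otimes>\<^bsub>H\<^esub> f w" if "w \<in> carrier G" for w
    using rel[OF that, symmetric] s fc that \<phi>c by (simp add: H.m_assoc)
  have comm: "f v \<otimes>\<^bsub>H\<^esub> s [^]\<^bsub>H\<^esub> n = s [^]\<^bsub>H\<^esub> n \<otimes>\<^bsub>H\<^esub> f (act n v)"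
    if v: "v \<in> carrier G" for n :: int and v
  proof (induction n rule: int_induct[where k = 0])
    case base
    then show ?case using v by (simp add: one_right_AutoGroup fc)
  next
    case (step1 n)
    have c: "act n v \<in> carrier G" by (rule auto_pow_closed[OF v])
    have "f v \<otimes>\<^bsub>H\<^esub> s [^]\<^bsub>H\<^esub> (n + 1) = s [^]\<^bsub>H\<^esub> n \<otimes>\<^bsub>H\<^esub> (f (act n v) \<otimes>\<^bsub>H\<^esub> s)"
      using step1 s v c by (simp add: H.int_pow_mult fc flip: H.m_assoc)
    also have "\<dots> = s [^]\<^bsub>H\<^esub> (n + 1) \<otimes>\<^bsub>H\<^esub> f (act (n + 1) v)"
      using s c v by (simp add: step auto_pow_add auto_pow_1 H.int_pow_mult H.m_assoc fc \<phi>c)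
    finally show ?case .
  next
    case (step2 n)
    have c: "act (n - 1) v \<in> carrier G" by (rule auto_pow_closed[OF v])
    have a: "act n v = \<phi> (act (n - 1) v)"
      using auto_pow_add[OF v, of "n - 1" 1] by (simp add: auto_pow_1)
    have p: "s [^]\<^bsub>H\<^esub> (n - 1) = s [^]\<^bsub>H\<^esub> n \<otimes>\<^bsub>H\<^esub> inv\<^bsub>H\<^esub> s"
      using s by (simp add: H.int_pow_diff)
    have "f v \<otimes>\<^bsub>H\<^esub> s [^]\<^bsub>H\<^esub> (n - 1) = s [^]\<^bsub>H\<^esub> n \<otimes>\<^bsub>H\<^esub> (f (act n v) \<otimes>\<^bsub>H\<^esub> inv\<^bsub>H\<^esub> s)"
      using step2 s v auto_pow_closed[OF v] by (simp add: p fc flip: H.m_assoc)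
    also have "\<dots> = s [^]\<^bsub>H\<^esub> (n - 1) \<otimes>\<^bsub>H\<^esub> f (act (n - 1) v)"
      using s c by (simp add: a step' p H.m_assoc fc)
    finally show ?case .
  qed
  define F where "F = (\<lambda>(n::int, w). s [^]\<^bsub>H\<^esub> n \<otimes>\<^bsub>H\<^esub> f w)"
  have "F \<in> hom (mapping_torus G \<phi>) H"
  proof (rule homI)
    fix x assume "x \<in> carrier (mapping_torus G \<phi>)"
    then show "F x \<in> carrier H" using s by (auto simp: F_def mapping_torus_def fc)
  next
    fix x y assume "x \<in> carrier (mapping_torus G \<phi>)" "y \<in> carrier (mapping_torus G \<phi>)"
    then obtain m v n w where xy: "x = (m, v)" "y = (n, w)" and vw: "v \<in> carrier G" "w \<in> carrier G"
      by (auto simp: mapping_torus_def)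
    have c: "act n v \<in> carrier G" by (rule auto_pow_closed[OF vw(1)])
    have "F x \<otimes>\<^bsub>H\<^esub> F y = s [^]\<^bsub>H\<^esub> m \<otimes>\<^bsub>H\<^esub> (f v \<otimes>\<^bsub>H\<^esub> s [^]\<^bsub>H\<^esub> n) \<otimes>\<^bsub>H\<^esub> f w"
      using s vw by (simp add: F_def xy H.m_assoc fc)
    also have "\<dots> = s [^]\<^bsub>H\<^esub> (m + n) \<otimes>\<^bsub>H\<^esub> (f (act n v) \<otimes>\<^bsub>H\<^esub> f w)"
      using s vw c by (simp add: comm H.int_pow_mult H.m_assoc fc)
    also have "\<dots> = F (x \<otimes>\<^bsub>mapping_torus G \<phi>\<^esub> y)"
      using vw c by (simp add: F_def xy mult_mapping_torus fm)
    finally show "F (x \<otimes>\<^bsub>mapping_torus G \<phi>\<^esub> y) = F x \<otimes>\<^bsub>H\<^esub> F y" by simp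
  qed
  moreover have "F (mt_stable G) = s"
    using s hom_one[OF f is_group H] by (simp add: F_def mt_stable_def)
  moreover have "\<forall>w \<in> carrier G. F (mt_incl w) = f w"
    by (simp add: F_def mt_incl_def fc)
  ultimately show ?thesis by blast
qed

theorem mapping_torus_unique:
  assumes H: "group H" and F: "F \<in> hom (mapping_torus G \<phi>) H"
    and F': "F' \<in> hom (mapping_torus G \<phi>) H"
    and t: "F (mt_stable G) = F' (mt_stable G)"
    and i: "\<And>w. w \<in> carrier G \<Longrightarrow> F (mt_incl w) = F' (mt_incl w)"
    and x: "x \<in> carrier (mapping_torus G \<phi>)"
  shows "F x = F' x"
proof -
  interpret M: group "mapping_torus G \<phi>" by (rule group_mapping_torus)
  obtain n w where nw: "x = (n, w)" "w \<in> carrier G"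
    using x by (auto simp: mapping_torus_def)
  have *: "E x = E (mt_stable G) [^]\<^bsub>H\<^esub> n \<otimes>\<^bsub>H\<^esub> E (mt_incl w)"
    if E: "E \<in> hom (mapping_torus G \<phi>) H" for E
  proof -
    have "E x = E (mt_stable G [^]\<^bsub>mapping_torus G \<phi>\<^esub> n \<otimes>\<^bsub>mapping_torus G \<phi>\<^esub> mt_incl w)"
      using mapping_torus_decomp[OF nw(2), of n] nw(1) by simp
    also have "\<dots> = E (mt_stable G [^]\<^bsub>mapping_torus G \<phi>\<^esub> n) \<otimes>\<^bsub>H\<^esub> E (mt_incl w)"
      using mt_stable_closed nw(2)
      by (intro hom_mult[OF E]) (auto simp: mt_incl_def carrier_mapping_torus)
    also have "E (mt_stable G [^]\<^bsub>mapping_torus G \<phi>\<^esub> n) = E (mt_stable G) [^]\<^bsub>H\<^esub> n"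
      by (rule hom_int_pow[OF E mt_stable_closed group_mapping_torus H])
    finally show ?thesis .
  qed
  show ?thesis using *[OF F] *[OF F'] t i[OF nw(2)] by simp
qed

end

end

end

theory Submission
  imports Defs "HOL-Algebra.Elementary_Groups"
begin

text \<open>
  Both sides of the equivalence say the same thing about the same element \<open>g\<close>.  On the one hand
  \<open>[\<phi>, \<chi>] = Ad(g)\<close> means \<open>\<phi> \<chi> = \<chi> \<phi> Ad(g)\<close>, that is, \<open>w \<phi> \<chi> = (w \<chi> \<phi>)\<^sup>g\<close> for all \<open>w\<close>
  (\<open>commutator_eq_Ad_iff\<close>).  On the other hand, conjugating by \<open>t\<close> in the mapping torus is
  applying \<open>\<phi>\<close>, so \<open>(w \<chi> \<phi>)\<^sup>g\<close> is the conjugate of \<open>w \<chi>\<close> by \<open>t g\<close> (\<open>conj_by_stable_mult\<close>).  Hence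
  the equation is exactly the image of the defining relation \<open>w\<^sup>t = w \<phi>\<close> under
  \<open>t \<mapsto> t g\<close>, \<open>w \<mapsto> w \<chi>\<close>, and it holds if and only if this assignment extends to an endomorphism of
  the mapping torus.

  Such an endomorphism is automatically bijective: it is a map of the extension
  \<open>1 \<rightarrow> G \<rightarrow> M\<^sub>\<phi> \<rightarrow> \<int> \<rightarrow> 1\<close> to itself that induces the automorphism \<open>\<chi>\<close> on \<open>G\<close> and the
  identity on \<open>\<int>\<close> (\<open>mapping_torus_endo_bij\<close>).
\<close>

context group
begin

lemma auto_imp_hom: "\<psi> \<in> auto G \<Longrightarrow> \<psi> \<in> hom G G"
  by (simp add: auto_def)

lemma auto_closed: "\<psi> \<in> auto G \<Longrightarrow> w \<in> carrier G \<Longrightarrow> \<psi> w \<in> carrier G"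
  by (auto simp: auto_def hom_def)

lemma auto_bij_betw: "\<psi> \<in> auto G \<Longrightarrow> bij_betw \<psi> (carrier G) (carrier G)"
  by (simp add: auto_def Bij_def)

lemma commutator_in_auto:
  assumes "\<phi> \<in> auto G" "\<chi> \<in> auto G"
  shows "commutator (right_AutoGroup G) \<phi> \<chi> \<in> auto G"
proof -
  interpret R: group "right_AutoGroup G" by (rule group_right_AutoGroup)
  have "\<phi> \<in> carrier (right_AutoGroup G)" "\<chi> \<in> carrier (right_AutoGroup G)"
    using assms by (simp_all add: right_AutoGroup_def)
  then have "commutator (right_AutoGroup G) \<phi> \<chi> \<in> carrier (right_AutoGroup G)"
    unfolding commutator_def by simp
  then show ?thesis by (simp add: right_AutoGroup_def)
qed

text \<open>The identity \<open>\<phi> \<chi> = \<chi> \<phi> [\<phi>, \<chi>]\<close>, read pointwise.\<close>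

lemma commutator_apply:
  assumes "\<phi> \<in> auto G" "\<chi> \<in> auto G" "w \<in> carrier G"
  shows "commutator (right_AutoGroup G) \<phi> \<chi> (\<phi> (\<chi> w)) = \<chi> (\<phi> w)"
proof -
  interpret R: group "right_AutoGroup G" by (rule group_right_AutoGroup)
  have c: "\<phi> \<in> carrier (right_AutoGroup G)" "\<chi> \<in> carrier (right_AutoGroup G)"
    using assms by (simp_all add: right_AutoGroup_def)
  have "commutator (right_AutoGroup G) \<phi> \<chi> = inv\<^bsub>right_AutoGroup G\<^esub> (\<chi> \<otimes>\<^bsub>right_AutoGroup G\<^esub> \<phi>)
      \<otimes>\<^bsub>right_AutoGroup G\<^esub> (\<phi> \<otimes>\<^bsub>right_AutoGroup G\<^esub> \<chi>)"
    using c by (simp add: commutator_def R.inv_mult_group R.m_assoc)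
  then have "\<phi> \<otimes>\<^bsub>right_AutoGroup G\<^esub> \<chi>
      = \<chi> \<otimes>\<^bsub>right_AutoGroup G\<^esub> \<phi> \<otimes>\<^bsub>right_AutoGroup G\<^esub> commutator (right_AutoGroup G) \<phi> \<chi>"
    using c by (subst (asm) R.inv_solve_left) (simp_all add: commutator_def)
  then have "compose (carrier G) \<chi> \<phi>
      = compose (carrier G) (commutator (right_AutoGroup G) \<phi> \<chi>) (compose (carrier G) \<phi> \<chi>)"
    by (simp add: right_AutoGroup_def)
  from fun_cong[OF this, of w] show ?thesis
    using assms(3) by (simp add: compose_eq)
qed

text \<open>
  Every element of \<open>G\<close> has the form \<open>\<phi> (\<chi> w)\<close>, so it is enough to compare \<open>[\<phi>, \<chi>]\<close> with
  \<open>Ad(g)\<close> there, where the values of \<open>[\<phi>, \<chi>]\<close> are known.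
\<close>

lemma commutator_eq_Ad_iff:
  assumes \<phi>: "\<phi> \<in> auto G" and \<chi>: "\<chi> \<in> auto G"
  shows "commutator (right_AutoGroup G) \<phi> \<chi> = Ad G g
    \<longleftrightarrow> (\<forall>w \<in> carrier G. inv g \<otimes> \<phi> (\<chi> w) \<otimes> g = \<chi> (\<phi> w))"
    (is "?c = _ \<longleftrightarrow> ?R")
proof
  assume c: "?c = Ad G g"
  show ?R
  proof
    fix w assume w: "w \<in> carrier G"
    then have "\<phi> (\<chi> w) \<in> carrier G"
      by (intro auto_closed[OF \<phi>] auto_closed[OF \<chi>])
    then show "inv g \<otimes> \<phi> (\<chi> w) \<otimes> g = \<chi> (\<phi> w)"
      using commutator_apply[OF \<phi> \<chi> w] unfolding c by (simp add: Ad_def)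
  qed
next
  assume R: ?R
  show "?c = Ad G g"
  proof (rule extensionalityI)
    show "?c \<in> extensional (carrier G)"
      using commutator_in_auto[OF \<phi> \<chi>] by (simp add: auto_def Bij_def)
    show "Ad G g \<in> extensional (carrier G)"
      by (simp add: Ad_def)
    fix v assume v: "v \<in> carrier G"
    have "carrier G = \<phi> ` \<chi> ` carrier G"
      using auto_bij_betw[OF \<phi>] auto_bij_betw[OF \<chi>] by (simp add: bij_betw_def)
    then have "v \<in> \<phi> ` \<chi> ` carrier G"
      using v by (rule subst)
    then obtain w where w: "w \<in> carrier G" "v = \<phi> (\<chi> w)"
      by (elim imageE) simp
    show "?c v = Ad G g v"
      using bspec[OF R w(1)] v commutator_apply[OF \<phi> \<chi> w(1)] unfolding w(2) by (simp add: Ad_def)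
  qed
qed

lemma mt_incl_closed: "w \<in> carrier G \<Longrightarrow> mt_incl w \<in> carrier (mapping_torus G \<phi>)"
  by (simp add: mt_incl_def carrier_mapping_torus)

lemma conj_by_stable_mult:
  assumes \<phi>: "\<phi> \<in> auto G" and g: "g \<in> carrier G" and v: "v \<in> carrier G"
  defines "s \<equiv> mt_stable G \<otimes>\<^bsub>mapping_torus G \<phi>\<^esub> mt_incl g"
  shows "inv\<^bsub>mapping_torus G \<phi>\<^esub> s \<otimes>\<^bsub>mapping_torus G \<phi>\<^esub> mt_incl v \<otimes>\<^bsub>mapping_torus G \<phi>\<^esub> s
    = mt_incl (inv g \<otimes> \<phi> v \<otimes> g)"
proof -
  interpret M: group "mapping_torus G \<phi>" by (rule group_mapping_torus[OF \<phi>])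
  interpret incl: group_hom G "mapping_torus G \<phi>" mt_incl
    by unfold_locales (rule mt_incl_hom[OF \<phi>])
  have "inv\<^bsub>mapping_torus G \<phi>\<^esub> s \<otimes>\<^bsub>mapping_torus G \<phi>\<^esub> mt_incl v \<otimes>\<^bsub>mapping_torus G \<phi>\<^esub> s
    = inv\<^bsub>mapping_torus G \<phi>\<^esub> mt_incl g \<otimes>\<^bsub>mapping_torus G \<phi>\<^esub>
      (inv\<^bsub>mapping_torus G \<phi>\<^esub> mt_stable G \<otimes>\<^bsub>mapping_torus G \<phi>\<^esub> mt_incl v
        \<otimes>\<^bsub>mapping_torus G \<phi>\<^esub> mt_stable G) \<otimes>\<^bsub>mapping_torus G \<phi>\<^esub> mt_incl g"
    using g v mt_stable_closed[OF \<phi>] by (simp add: s_def M.inv_mult_group M.m_assoc)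
  also have "\<dots> = mt_incl (inv g \<otimes> \<phi> v \<otimes> g)"
    using g v by (simp add: mapping_torus_relation[OF \<phi>] auto_closed[OF \<phi>])
  finally show ?thesis .
qed

text \<open>
  The first coordinate is the projection of the mapping torus onto \<open>\<int>\<close>, and a homomorphism to
  \<open>\<int>\<close> is determined by its values on the generators.
\<close>

lemma mapping_torus_endo_fst:
  assumes \<phi>: "\<phi> \<in> auto G" and F: "F \<in> hom (mapping_torus G \<phi>) (mapping_torus G \<phi>)"
    and t: "fst (F (mt_stable G)) = 1"
    and i: "\<And>w. w \<in> carrier G \<Longrightarrow> fst (F (mt_incl w)) = 0"
    and x: "x \<in> carrier (mapping_torus G \<phi>)"
  shows "fst (F x) = fst x"
proof -
  have p: "fst \<in> hom (mapping_torus G \<phi>) integer_group"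
    by (auto simp: hom_def mapping_torus_def integer_group_def)
  have "(fst \<circ> F) x = fst x"
    using t i
    by (intro mapping_torus_unique[OF \<phi> group_integer_group Group.hom_compose[OF F p] p _ _ x])
      (simp_all add: mt_stable_def mt_incl_def)
  then show ?thesis by simp
qed

text \<open>
  A diagram chase.  An element of the kernel has exponent \<open>0\<close>, so it lies in \<open>G\<close>, where \<open>\<chi>\<close> is
  injective.  For surjectivity, the image of \<open>t\<^sup>n\<close> has the form \<open>t\<^sup>n u\<close>, and \<open>u\<close> can be corrected to
  any prescribed element of \<open>G\<close> because \<open>\<chi>\<close> is onto.
\<close>

lemma mapping_torus_endo_bij:
  assumes \<phi>: "\<phi> \<in> auto G" and \<chi>: "\<chi> \<in> auto G"
    and F: "F \<in> hom (mapping_torus G \<phi>) (mapping_torus G \<phi>)"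
    and t: "fst (F (mt_stable G)) = 1"
    and i: "\<And>w. w \<in> carrier G \<Longrightarrow> F (mt_incl w) = mt_incl (\<chi> w)"
  shows "bij_betw F (carrier (mapping_torus G \<phi>)) (carrier (mapping_torus G \<phi>))"
proof -
  interpret M: group "mapping_torus G \<phi>" by (rule group_mapping_torus[OF \<phi>])
  interpret F: group_hom "mapping_torus G \<phi>" "mapping_torus G \<phi>" F
    by unfold_locales (rule F)
  interpret \<chi>: group_hom G G \<chi>
    by unfold_locales (rule auto_imp_hom[OF \<chi>])
  have F_fst: "fst (F x) = fst x" if "x \<in> carrier (mapping_torus G \<phi>)" for x
    by (rule mapping_torus_endo_fst[OF \<phi> F t _ that]) (simp add: i, simp add: mt_incl_def)
  have "inj_on F (carrier (mapping_torus G \<phi>))"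
  proof (subst F.inj_on_one_iff, intro allI impI)
    fix x assume x: "x \<in> carrier (mapping_torus G \<phi>)" and Fx: "F x = \<one>\<^bsub>mapping_torus G \<phi>\<^esub>"
    obtain w where w: "x = mt_incl w" "w \<in> carrier G"
      using x Fx F_fst[OF x] by (cases x) (auto simp: mapping_torus_def mt_incl_def)
    then have "\<chi> w = \<chi> \<one>"
      using Fx by (simp add: i) (simp add: mt_incl_def mapping_torus_def)
    then have "w = \<one>"
      using w auto_bij_betw[OF \<chi>] by (auto simp: bij_betw_def inj_on_def)
    then show "x = \<one>\<^bsub>mapping_torus G \<phi>\<^esub>"
      by (simp add: w mt_incl_def mapping_torus_def)
  qed
  moreover have "carrier (mapping_torus G \<phi>) \<subseteq> F ` carrier (mapping_torus G \<phi>)"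
  proof
    fix y assume "y \<in> carrier (mapping_torus G \<phi>)"
    then obtain n v where y: "y = (n, v)" and v: "v \<in> carrier G"
      by (auto simp: mapping_torus_def)
    have n: "(n, \<one>) \<in> carrier (mapping_torus G \<phi>)"
      by (simp add: carrier_mapping_torus)
    obtain u where u: "F (n, \<one>) = (n, u)"
      using F_fst[OF n] by (cases "F (n, \<one>)") simp
    then have uc: "u \<in> carrier G"
      using F.hom_closed[OF n] by (simp add: carrier_mapping_torus)
    have "inv u \<otimes> v \<in> \<chi> ` carrier G"
      using uc v auto_bij_betw[OF \<chi>] by (simp add: bij_betw_def)
    then obtain w where w: "w \<in> carrier G" "\<chi> w = inv u \<otimes> v"
      by auto
    have "F ((n, \<one>) \<otimes>\<^bsub>mapping_torus G \<phi>\<^esub> mt_incl w) = (n, u) \<otimes>\<^bsub>mapping_torus G \<phi>\<^esub> mt_incl (\<chi> w)"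
      using n w(1) by (simp add: mt_incl_closed u i)
    also have "\<dots> = y"
      using uc v by (simp add: w(2) y mt_incl_def mult_mapping_torus one_right_AutoGroup[OF \<phi>]
          flip: m_assoc)
    finally show "y \<in> F ` carrier (mapping_torus G \<phi>)"
      using n mt_incl_closed[OF w(1)] by (metis M.m_closed imageI)
  qed
  ultimately show ?thesis
    using F.hom_closed by (auto simp: bij_betw_def)
qed

text \<open>
  The universal property asks only for the relation \<open>w\<^sup>t = w \<phi>\<close> to be preserved, which by
  \<open>conj_by_stable_mult\<close> is the stated equation; conversely an endomorphism preserves it.  The
  restriction to the carrier turns the bijective endomorphism into a member of \<open>auto\<close>, whose
  elements are undefined outside the carrier.
\<close>

lemma mapping_torus_auto_iff:
  assumes \<phi>: "\<phi> \<in> auto G" and \<chi>: "\<chi> \<in> auto G" and g: "g \<in> carrier G"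
  shows "(\<exists>\<Psi> \<in> auto (mapping_torus G \<phi>).
       \<Psi> (mt_stable G) = mt_stable G \<otimes>\<^bsub>mapping_torus G \<phi>\<^esub> mt_incl g \<and>
       (\<forall>w \<in> carrier G. \<Psi> (mt_incl w) = mt_incl (\<chi> w)))
    \<longleftrightarrow> (\<forall>w \<in> carrier G. inv g \<otimes> \<phi> (\<chi> w) \<otimes> g = \<chi> (\<phi> w))" (is "?L \<longleftrightarrow> ?R")
proof -
  interpret M: group "mapping_torus G \<phi>" by (rule group_mapping_torus[OF \<phi>])
  note t = mt_stable_closed[OF \<phi>]
  define s where "s = mt_stable G \<otimes>\<^bsub>mapping_torus G \<phi>\<^esub> mt_incl g"
  have s: "s \<in> carrier (mapping_torus G \<phi>)"
    using t g by (simp add: s_def mt_incl_closed)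
  have conj: "inv\<^bsub>mapping_torus G \<phi>\<^esub> s \<otimes>\<^bsub>mapping_torus G \<phi>\<^esub> mt_incl (\<chi> w) \<otimes>\<^bsub>mapping_torus G \<phi>\<^esub> s
      = mt_incl (inv g \<otimes> \<phi> (\<chi> w) \<otimes> g)" if "w \<in> carrier G" for w
    unfolding s_def using conj_by_stable_mult[OF \<phi> g] that by (simp add: auto_closed[OF \<chi>])
  show ?thesis
  proof
    assume ?L
    then obtain \<Psi> where \<Psi>: "\<Psi> \<in> auto (mapping_torus G \<phi>)"
      and \<Psi>t: "\<Psi> (mt_stable G) = s" and \<Psi>i: "\<And>w. w \<in> carrier G \<Longrightarrow> \<Psi> (mt_incl w) = mt_incl (\<chi> w)"
      by (auto simp: s_def)
    interpret \<Psi>: group_hom "mapping_torus G \<phi>" "mapping_torus G \<phi>" \<Psi>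
      by unfold_locales (rule M.auto_imp_hom[OF \<Psi>])
    show ?R
    proof
      fix w assume w: "w \<in> carrier G"
      have "mt_incl (inv g \<otimes> \<phi> (\<chi> w) \<otimes> g)
          = \<Psi> (inv\<^bsub>mapping_torus G \<phi>\<^esub> mt_stable G \<otimes>\<^bsub>mapping_torus G \<phi>\<^esub> mt_incl w
            \<otimes>\<^bsub>mapping_torus G \<phi>\<^esub> mt_stable G)"
        using w t by (simp add: conj \<Psi>t \<Psi>i mt_incl_closed)
      also have "\<dots> = mt_incl (\<chi> (\<phi> w))"
        using w by (simp add: mapping_torus_relation[OF \<phi>] \<Psi>i auto_closed[OF \<phi>])
      finally show "inv g \<otimes> \<phi> (\<chi> w) \<otimes> g = \<chi> (\<phi> w)"
        by (simp add: mt_incl_def)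
    qed
  next
    assume R: ?R
    have "\<exists>F \<in> hom (mapping_torus G \<phi>) (mapping_torus G \<phi>).
        F (mt_stable G) = s \<and> (\<forall>w \<in> carrier G. F (mt_incl w) = (mt_incl \<circ> \<chi>) w)"
    proof (rule mapping_torus_universal[OF \<phi> M.is_group _ s])
      show "mt_incl \<circ> \<chi> \<in> hom G (mapping_torus G \<phi>)"
        by (rule Group.hom_compose[OF auto_imp_hom[OF \<chi>] mt_incl_hom[OF \<phi>]])
    qed (use R in \<open>simp add: conj\<close>)
    then obtain F where F: "F \<in> hom (mapping_torus G \<phi>) (mapping_torus G \<phi>)"
      and Ft: "F (mt_stable G) = s"
      and Fi: "\<And>w. w \<in> carrier G \<Longrightarrow> F (mt_incl w) = mt_incl (\<chi> w)"
      by auto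
    have "fst (F (mt_stable G)) = 1"
      unfolding Ft s_def by (simp add: mt_stable_def mt_incl_def mult_mapping_torus)
    then have "bij_betw F (carrier (mapping_torus G \<phi>)) (carrier (mapping_torus G \<phi>))"
      by (rule mapping_torus_endo_bij[OF \<phi> \<chi> F _ Fi])
    then have "restrict F (carrier (mapping_torus G \<phi>)) \<in> auto (mapping_torus G \<phi>)"
      using F by (auto simp: auto_def Bij_def hom_def Pi_iff bij_betw_restrict_eq)
    moreover have "restrict F (carrier (mapping_torus G \<phi>)) (mt_stable G) = s"
      using t Ft by simp
    moreover have "\<forall>w \<in> carrier G. restrict F (carrier (mapping_torus G \<phi>)) (mt_incl w) = mt_incl (\<chi> w)"
      by (simp add: mt_incl_closed Fi)
    ultimately show ?L
      unfolding s_def by blast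
  qed
qed

end

theorem lemma1p3:
  fixes G :: "('a, 'b) monoid_scheme" and \<phi> \<chi> :: "'a \<Rightarrow> 'a"
  assumes "group G" and "\<phi> \<in> auto G" and "\<chi> \<in> auto G"
  shows "commutator (right_AutoGroup G) \<phi> \<chi> \<in> Inn G \<longleftrightarrow>
    (\<exists>g \<in> carrier G. \<exists>\<Psi> \<in> auto (mapping_torus G \<phi>).
       \<Psi> (mt_stable G) = mt_stable G \<otimes>\<^bsub>mapping_torus G \<phi>\<^esub> mt_incl g \<and>
       (\<forall>w \<in> carrier G. \<Psi> (mt_incl w) = mt_incl (\<chi> w)))"
proof -
  interpret group G by (rule assms(1))
  have "commutator (right_AutoGroup G) \<phi> \<chi> \<in> Inn G
      \<longleftrightarrow> (\<exists>g \<in> carrier G. commutator (right_AutoGroup G) \<phi> \<chi> = Ad G g)"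
    by (auto simp: Inn_def)
  then show ?thesis
    by (simp add: commutator_eq_Ad_iff[OF assms(2,3)] mapping_torus_auto_iff[OF assms(2,3)])
qed

end
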